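(* Let $(X,Y),(X_1,Y_1),\dots,(X_n,Y_n)$ be i.i.d. random pairs in $\mathbb R^d\times\{-1,1\}$ with $\|X\|\le R$ almost surely for some constant $R>0$. Then the Ridge-regularized logistic Sample Minmax Predictor $\widetilde f_{\lambda,n}$ with $\lambda=2R^2/(n+1)$ satisfies, for every $B>0$, $$\mathbb E\big[\mathcal R(\widetilde f_{\lambda,n})\big]-\inf_{\theta\in\mathbb R^d:\ \|\theta\|\le B}\mathcal R(f_\theta)\le\frac{e\cdot d+B^2R^2}{n}.$$
   Context: Let $\sigma(u)=e^u/(1+e^u)$. The logistic model is $f_\theta(y\mid x)=\sigma(y\langle\theta,x\rangle)$ for $\theta,x\in\mathbb R^d$, $y\in\{-1,1\}$. For a conditional probability mass function $g(y\mid x)$ on $\{-1,1\}$, the risk is $\mathcal R(g)=\mathbb E[-\log g(Y\mid X)]$; $\mathbb E[\mathcal R(\widetilde f_{\lambda,n})]$ is the expectation over the sample. For $(x,y)\in\mathbb R^d\times\{-1,1\}$ let $$\widehat\theta_{\lambda,n}^{(x,y)}=\operatorname*{arg\,min}_{\theta\in\mathbb R^d}\Big\{\frac1{n+1}\Big(\sum_{i=1}^n\log(1+e^{-Y_i\langle\theta,X_i\rangle})+\log(1+e^{-y\langle\theta,x\rangle})\Big)+\frac\lambda2\|\theta\|^2\Big\}.$$ The Ridge-regularized logistic Sample Minmax Predictor is $$\widetilde f_{\lambda,n}(y\mid x)=\frac{\sigma(y\langle\widehat\theta_{\lambda,n}^{(x,y)},x\rangle)\,e^{-\lambda\|\widehat\theta_{\lambda,n}^{(x,y)}\|^2/2}}{\sigma(\langle\widehat\theta_{\lambda,n}^{(x,1)},x\rangle)\,e^{-\lambda\|\widehat\theta_{\lambda,n}^{(x,1)}\|^2/2}+\sigma(-\langle\widehat\theta_{\lambda,n}^{(x,-1)},x\rangle)\,e^{-\lambda\|\widehat\theta_{\lambda,n}^{(x,-1)}\|^2/2}}.$$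 *)

theory Defs
  imports "HOL-Probability.Probability"
begin

definition sigmoid :: "real \<Rightarrow> real" where
  "sigmoid u = exp u / (1 + exp u)"

text \<open>
  Labels are the reals \<open>-1\<close> and \<open>1\<close>. A conditional probability mass function \<open>g(y | x)\<close>
  is a curried function \<open>g y x\<close>, of which only the values at \<open>y = -1\<close> and \<open>y = 1\<close> matter.
\<close>

definition logistic_model :: "real ^ 'd \<Rightarrow> real \<Rightarrow> real ^ 'd \<Rightarrow> real" where
  "logistic_model \<theta> y x = sigmoid (y * (\<theta> \<bullet> x))"

text \<open>
  The risk is a functional of a fixed \<open>g\<close>: applied to a predictor built from the sample,
  it integrates over the test pair \<open>(X, Y)\<close> only.
\<close>

definition risk ::
    "'w measure \<Rightarrow> ('w \<Rightarrow> real ^ 'd) \<Rightarrow> ('w \<Rightarrow> real) \<Rightarrow> (real \<Rightarrow> real ^ 'd \<Rightarrow> real) \<Rightarrow> real" where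
  "risk M X Y g = (\<integral>\<omega>. - ln (g (Y \<omega>) (X \<omega>)) \<partial>M)"

text \<open>
  A sample of size \<open>n\<close> is a pair of sequences \<open>xs\<close>, \<open>ys\<close>, of which only the entries with index
  in \<open>{1..n}\<close> are used (index \<open>0\<close> is left for the test pair).
  The pair \<open>(x, y)\<close> is the additional, virtual observation.
\<close>

definition ridge_objective ::
    "real \<Rightarrow> nat \<Rightarrow> (nat \<Rightarrow> real ^ 'd) \<Rightarrow> (nat \<Rightarrow> real) \<Rightarrow> real ^ 'd \<Rightarrow> real \<Rightarrow> real ^ 'd \<Rightarrow> real" where
  "ridge_objective lam n xs ys x y \<theta> =
     1 / (real n + 1) *
       ((\<Sum>i=1..n. ln (1 + exp (- ys i * (\<theta> \<bullet> xs i)))) + ln (1 + exp (- y * (\<theta> \<bullet> x))))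
     + lam / 2 * (norm \<theta>)\<^sup>2"

text \<open>For \<open>lam > 0\<close> the objective is strongly convex, so its minimizer exists and is unique.\<close>

definition ridge_estimator ::
    "real \<Rightarrow> nat \<Rightarrow> (nat \<Rightarrow> real ^ 'd) \<Rightarrow> (nat \<Rightarrow> real) \<Rightarrow> real ^ 'd \<Rightarrow> real \<Rightarrow> real ^ 'd" where
  "ridge_estimator lam n xs ys x y = arg_min (ridge_objective lam n xs ys x y) (\<lambda>_. True)"

definition smp_weight ::
    "real \<Rightarrow> nat \<Rightarrow> (nat \<Rightarrow> real ^ 'd) \<Rightarrow> (nat \<Rightarrow> real) \<Rightarrow> real \<Rightarrow> real ^ 'd \<Rightarrow> real" where
  "smp_weight lam n xs ys y x =
     sigmoid (y * (ridge_estimator lam n xs ys x y \<bullet> x)) *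
       exp (- lam * (norm (ridge_estimator lam n xs ys x y))\<^sup>2 / 2)"

definition ridge_logistic_smp ::
    "real \<Rightarrow> nat \<Rightarrow> (nat \<Rightarrow> real ^ 'd) \<Rightarrow> (nat \<Rightarrow> real) \<Rightarrow> real \<Rightarrow> real ^ 'd \<Rightarrow> real" where
  "ridge_logistic_smp lam n xs ys y x =
     smp_weight lam n xs ys y x / (smp_weight lam n xs ys 1 x + smp_weight lam n xs ys (-1) x)"

end

theory Submission
  imports Defs
begin

text \<open>
  Write \<open>\<theta>\<^sub>1\<close>, \<open>\<theta>\<^sub>-\<^sub>1\<close> for the minimizers with the virtual observation \<open>x\<close> labelled \<open>1\<close> and \<open>-1\<close>.
  The logarithm of the normalizing constant of the predictor is at most
  \<open>\<delta> = \<sigma>(\<langle>\<theta>\<^sub>1, x\<rangle>) - \<sigma>(\<langle>\<theta>\<^sub>-\<^sub>1, x\<rangle>)\<close>.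
  Subtracting the two stationarity conditions gives \<open>(H + (n + 1) \<lambda>) \<Delta> = x\<close> for \<open>\<Delta> = \<theta>\<^sub>1 - \<theta>\<^sub>-\<^sub>1\<close>,
  where \<open>H\<close> is a Hessian along the segment, including the term of \<open>x\<close>. Hence \<open>\<delta>\<close> is a leverage
  score of \<open>x\<close>. With \<open>(n + 1) \<lambda> = 2 R\<^sup>2\<close>, self-concordance allows replacing \<open>H\<close>, at
  the cost of a factor \<open>e\<close>, by the Hessian at the minimizer for the true labels, which is symmetric in
  all \<open>n + 1\<close> observations, and the leverage scores then sum to at most the dimension. Averaging over the
  exchangeable choice of the test pair turns the remaining terms into the minimum of the
  regularized empirical risk of \<open>n + 1\<close> observations, whose expectation is at most
  that of its value at any fixed \<open>\<theta>\<close>.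
\<close>

section \<open>The sigmoid function\<close>

lemma sigmoid_pos: "0 < sigmoid u"
  by (simp add: sigmoid_def add_pos_pos)

lemma sigmoid_minus: "sigmoid (- u) = 1 - sigmoid u"
  by (simp add: sigmoid_def exp_minus field_simps add_pos_pos add_nonneg_eq_0_iff)

lemma sigmoid_le_1: "sigmoid u \<le> 1"
  using sigmoid_pos[of "- u"] by (simp add: sigmoid_minus)

lemma minus_ln_sigmoid: "- ln (sigmoid u) = ln (1 + exp (- u))"
proof -
  have "sigmoid u = inverse (1 + exp (- u))"
    by (simp add: sigmoid_def exp_minus field_simps)
  then show ?thesis by (simp add: ln_inverse add_pos_pos)
qed

lemma DERIV_sigmoid: "(sigmoid has_real_derivative sigmoid u * sigmoid (- u)) (at u)"
proof -
  have nz: "1 + exp u \<noteq> 0" using exp_gt_zero[of u] by linarith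
  then have eq: "sigmoid (- u) = 1 / (1 + exp u)"
    by (simp add: sigmoid_minus) (simp add: sigmoid_def field_simps)
  show ?thesis
    unfolding eq unfolding sigmoid_def[abs_def]
    using nz by (auto intro!: derivative_eq_intros simp: power2_eq_square field_simps)
qed

lemma DERIV_softplus:
  "((\<lambda>u. ln (1 + exp (- u))) has_real_derivative - sigmoid (- u)) (at u)"
proof -
  have "1 + exp (- u) > 0" using exp_gt_zero[of "- u"] by linarith
  then show ?thesis
    by (auto intro!: derivative_eq_intros simp: sigmoid_def field_simps)
qed

lemma sigmoid_mono: "u \<le> v \<Longrightarrow> sigmoid u \<le> sigmoid v"
  by (rule DERIV_nonneg_imp_nondecreasing[of u v sigmoid])
     (auto intro: DERIV_sigmoid simp: sigmoid_pos less_imp_le)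

lemma sigmoid_le_exp_diff:
  assumes "v \<le> u" shows "sigmoid u \<le> exp (u - v) * sigmoid v"
proof -
  have "exp u / (1 + exp u) \<le> exp u / (1 + exp v)"
    using assms by (intro divide_left_mono) (auto simp: add_pos_pos)
  then show ?thesis by (simp add: sigmoid_def exp_diff)
qed

text \<open>Self-concordance of the logistic loss: between \<open>v\<close> and \<open>u\<close> one
  of the two factors grows by at most \<open>exp \<bar>u - v\<bar>\<close>, and the other does not
  increase.\<close>

lemma sigmoid_deriv_ratio:
  "sigmoid u * sigmoid (- u) \<le> exp \<bar>u - v\<bar> * (sigmoid v * sigmoid (- v))"
proof (cases "v \<le> u")
  case True
  have "sigmoid u * sigmoid (- u) \<le> (exp (u - v) * sigmoid v) * sigmoid (- v)"
    using True sigmoid_le_exp_diff[OF True] sigmoid_mono[of "- u" "- v"]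
    by (intro mult_mono) (auto simp: sigmoid_pos less_imp_le)
  then show ?thesis using True by simp
next
  case False
  then have *: "u \<le> v" "- v \<le> - u" by auto
  have "sigmoid u * sigmoid (- u) \<le> sigmoid v * (exp (- u - - v) * sigmoid (- v))"
    using * sigmoid_le_exp_diff[OF *(2)] sigmoid_mono[of u v]
    by (intro mult_mono) (auto simp: sigmoid_pos less_imp_le)
  then show ?thesis using * by (simp add: mult_ac)
qed

lemma continuous_on_sigmoid [continuous_intros]:
  "continuous_on S f \<Longrightarrow> continuous_on S (\<lambda>x. sigmoid (f x))"
  unfolding sigmoid_def
  by (intro continuous_intros) (auto simp: add_pos_pos add_nonneg_eq_0_iff)

lemma tendsto_sigmoid [tendsto_intros]:
  "(f \<longlongrightarrow> l) F \<Longrightarrow> ((\<lambda>x. sigmoid (f x)) \<longlongrightarrow> sigmoid l) F"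
  by (rule isCont_tendsto_compose[OF DERIV_isCont[OF DERIV_sigmoid]])

section \<open>Minimizers of the regularized loss\<close>

text \<open>In the application this is the ridge objective times \<open>n + 1\<close>, with
  \<open>\<mu> = (n + 1) * lam\<close>, and \<open>a i\<close> is a feature vector multiplied by its
  label.\<close>

definition reg_loss :: "'i set \<Rightarrow> ('i \<Rightarrow> 'a::euclidean_space) \<Rightarrow> real \<Rightarrow> 'a \<Rightarrow> real" where
  "reg_loss I a \<mu> \<theta> = (\<Sum>i\<in>I. ln (1 + exp (- (\<theta> \<bullet> a i)))) + \<mu> / 2 * (norm \<theta>)\<^sup>2"

definition reg_grad :: "'i set \<Rightarrow> ('i \<Rightarrow> 'a::euclidean_space) \<Rightarrow> real \<Rightarrow> 'a \<Rightarrow> 'a" where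
  "reg_grad I a \<mu> \<theta> = \<mu> *\<^sub>R \<theta> - (\<Sum>i\<in>I. sigmoid (- (\<theta> \<bullet> a i)) *\<^sub>R a i)"

definition reg_min :: "'i set \<Rightarrow> ('i \<Rightarrow> 'a::euclidean_space) \<Rightarrow> real \<Rightarrow> 'a" where
  "reg_min I a \<mu> = arg_min (reg_loss I a \<mu>) (\<lambda>_. True)"

lemma reg_loss_ge: "\<mu> / 2 * (norm \<theta>)\<^sup>2 \<le> reg_loss I a \<mu> \<theta>"
  by (simp add: reg_loss_def sum_nonneg)

lemma reg_loss_zero: "reg_loss I a \<mu> 0 = real (card I) * ln 2"
  by (simp add: reg_loss_def)

lemma continuous_on_reg_loss: "continuous_on S (reg_loss I a \<mu>)"
proof -
  have "1 + exp u \<noteq> 0" for u :: real using exp_gt_zero[of u] by linarith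
  then show ?thesis
    unfolding reg_loss_def[abs_def] by (intro continuous_intros) auto
qed

lemma reg_loss_has_derivative:
  fixes a :: "'i \<Rightarrow> 'a::euclidean_space"
  shows "(reg_loss I a \<mu> has_derivative (\<lambda>v. reg_grad I a \<mu> \<theta> \<bullet> v)) (at \<theta>)"
proof -
  have d: "((\<lambda>\<theta>. ln (1 + exp (- (\<theta> \<bullet> a i)))) has_derivative
          (\<lambda>v. - sigmoid (- (\<theta> \<bullet> a i)) * (v \<bullet> a i))) (at \<theta>)" for i
    by (rule has_derivative_compose[OF _ DERIV_softplus[unfolded has_field_derivative_def]])
       (auto intro!: derivative_eq_intros)
  have n: "((\<lambda>\<theta>::'a. \<mu> / 2 * (\<theta> \<bullet> \<theta>)) has_derivative (\<lambda>v. \<mu> * (\<theta> \<bullet> v))) (at \<theta>)"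
    by (auto intro!: derivative_eq_intros simp: inner_commute)
  show ?thesis
    unfolding reg_loss_def[abs_def] power2_norm_eq_inner
    by (rule has_derivative_eq_rhs[OF has_derivative_add[OF has_derivative_sum[OF d] n]])
       (auto simp: reg_grad_def inner_diff_right inner_sum_right inner_commute sum_negf)
qed

text \<open>\<open>arg_min\<close> is a choice, so existence must be shown: continuity gives a
  minimizer on a ball, and outside it the ridge term alone is at least the loss at 0.\<close>

lemma reg_min_le:
  assumes "\<mu> > 0"
  shows "reg_loss I a \<mu> (reg_min I a \<mu>) \<le> reg_loss I a \<mu> \<theta>"
proof -
  \<comment> \<open>Chosen so that \<open>\<mu> / 2 * K\<^sup>2\<close> equals the loss at
    0.\<close>
  define K where "K = sqrt (2 * (real (card I) * ln 2) / \<mu>)"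
  have K: "K \<ge> 0" "K\<^sup>2 = 2 * (real (card I) * ln 2) / \<mu>"
    using assms by (auto simp: K_def)
  have "\<exists>t\<in>cball 0 K. \<forall>s\<in>cball 0 K. reg_loss I a \<mu> t \<le> reg_loss I a \<mu> s"
    using K by (intro continuous_attains_inf continuous_on_reg_loss) auto
  then obtain t where t: "\<And>s. norm s \<le> K \<Longrightarrow> reg_loss I a \<mu> t \<le> reg_loss I a \<mu> s"
    by (metis mem_cball_0)
  have "reg_loss I a \<mu> t \<le> reg_loss I a \<mu> s" for s
  proof (cases "norm s \<le> K")
    case False
    then have "K\<^sup>2 \<le> (norm s)\<^sup>2" using K by (intro power_mono) auto
    then have "real (card I) * ln 2 \<le> \<mu> / 2 * (norm s)\<^sup>2"
      using assms by (simp add: K field_simps)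
    with reg_loss_ge[of \<mu> s I a] t[of 0] K reg_loss_zero[of I a \<mu>] show ?thesis
      by simp
  qed (use t in auto)
  then have "is_arg_min (reg_loss I a \<mu>) (\<lambda>_. True) t"
    by (auto simp: is_arg_min_linorder)
  then have "is_arg_min (reg_loss I a \<mu>) (\<lambda>_. True) (reg_min I a \<mu>)"
    unfolding reg_min_def arg_min_def by (rule someI)
  then show ?thesis by (auto simp: is_arg_min_linorder)
qed

text \<open>Comparison with the loss at 0. The bound is uniform in \<open>a\<close>, which later
  makes the loss of the predictor bounded.\<close>

lemma norm_reg_min_le:
  assumes "\<mu> > 0"
  shows "norm (reg_min I a \<mu>) \<le> sqrt (2 * real (card I) * ln 2 / \<mu>)"
proof (rule real_le_rsqrt)
  have "\<mu> / 2 * (norm (reg_min I a \<mu>))\<^sup>2 \<le> real (card I) * ln 2"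
    using reg_loss_ge reg_min_le[OF assms, of I a 0] unfolding reg_loss_zero by (rule order_trans)
  then show "(norm (reg_min I a \<mu>))\<^sup>2 \<le> 2 * real (card I) * ln 2 / \<mu>"
    using assms by (simp add: field_simps)
qed

lemma reg_grad_reg_min:
  assumes "\<mu> > 0"
  shows "reg_grad I a \<mu> (reg_min I a \<mu>) = 0"
proof -
  have "(\<lambda>v. reg_grad I a \<mu> (reg_min I a \<mu>) \<bullet> v) = (\<lambda>v. 0)"
    using reg_min_le[OF assms]
    by (intro differential_zero_maxmin[OF _ open_UNIV reg_loss_has_derivative]) auto
  then have "reg_grad I a \<mu> (reg_min I a \<mu>) \<bullet> reg_grad I a \<mu> (reg_min I a \<mu>) = 0"
    by meson
  then show ?thesis by simp
qed

text \<open>The ridge term contributes the left-hand side exactly; the logistic terms are convex, so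
  their gradients contribute a nonnegative sum.\<close>

lemma reg_grad_strongly_monotone:
  "\<mu> * (norm (\<theta> - \<theta>'))\<^sup>2 \<le> (reg_grad I a \<mu> \<theta> - reg_grad I a \<mu> \<theta>') \<bullet> (\<theta> - \<theta>')"
proof -
  let ?s = "\<lambda>i. (sigmoid (- (\<theta>' \<bullet> a i)) - sigmoid (- (\<theta> \<bullet> a i))) * (a i \<bullet> (\<theta> - \<theta>'))"
  have "0 \<le> ?s i" for i
    using sigmoid_mono[of "- (\<theta>' \<bullet> a i)" "- (\<theta> \<bullet> a i)"] sigmoid_mono[of "- (\<theta> \<bullet> a i)" "- (\<theta>' \<bullet> a i)"]
    by (cases "\<theta> \<bullet> a i \<le> \<theta>' \<bullet> a i")
       (auto simp: inner_diff_right inner_commute intro: mult_nonneg_nonneg mult_nonpos_nonpos)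
  then have "0 \<le> (\<Sum>i\<in>I. ?s i)" by (intro sum_nonneg)
  moreover have "(reg_grad I a \<mu> \<theta> - reg_grad I a \<mu> \<theta>') \<bullet> (\<theta> - \<theta>')
      = \<mu> * (norm (\<theta> - \<theta>'))\<^sup>2 + (\<Sum>i\<in>I. ?s i)"
    by (simp add: reg_grad_def power2_norm_eq_inner inner_diff_left inner_diff_right inner_sum_left
        left_diff_distrib right_diff_distrib sum_subtractf sum.distrib)
  ultimately show ?thesis by simp
qed

text \<open>Strong monotonicity against the minimizer, where the gradient vanishes, followed by
  Cauchy-Schwarz.\<close>

lemma norm_diff_reg_min_le:
  assumes "\<mu> > 0"
  shows "norm (\<theta> - reg_min I a \<mu>) \<le> norm (reg_grad I a \<mu> \<theta>) / \<mu>"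
proof (cases "\<theta> = reg_min I a \<mu>")
  case False
  let ?d = "\<theta> - reg_min I a \<mu>"
  have "\<mu> * (norm ?d)\<^sup>2 \<le> norm (reg_grad I a \<mu> \<theta>) * norm ?d"
    using reg_grad_strongly_monotone[of \<mu> \<theta> "reg_min I a \<mu>" I a]
      norm_cauchy_schwarz[of "reg_grad I a \<mu> \<theta>" ?d]
    by (simp add: reg_grad_reg_min[OF assms])
  moreover have "norm ?d > 0" using False by simp
  ultimately show ?thesis using assms
    by (simp add: power2_eq_square field_simps)
qed (use assms in simp)

text \<open>The perturbed gradient at the limiting minimizer tends to 0 and controls the distance.
  This continuity in the data later yields measurability.\<close>

lemma tendsto_reg_min:
  assumes "\<mu> > 0" and a: "\<And>i. i \<in> I \<Longrightarrow> ((\<lambda>t. a t i) \<longlongrightarrow> b i) F"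
  shows "((\<lambda>t. reg_min I (a t) \<mu>) \<longlongrightarrow> reg_min I b \<mu>) F"
proof -
  let ?\<theta> = "reg_min I b \<mu>"
  have "((\<lambda>t. reg_grad I (a t) \<mu> ?\<theta>) \<longlongrightarrow> reg_grad I b \<mu> ?\<theta>) F"
    unfolding reg_grad_def by (intro tendsto_intros a)
  then have "((\<lambda>t. norm (reg_grad I (a t) \<mu> ?\<theta>) / \<mu>) \<longlongrightarrow> norm (reg_grad I b \<mu> ?\<theta>) / \<mu>) F"
    using assms by (intro tendsto_intros) auto
  then have lim: "((\<lambda>t. norm (reg_grad I (a t) \<mu> ?\<theta>) / \<mu>) \<longlongrightarrow> 0) F"
    by (simp add: reg_grad_reg_min[OF assms(1)])
  have "((\<lambda>t. dist (reg_min I (a t) \<mu>) ?\<theta>) \<longlongrightarrow> 0) F"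
    by (rule tendsto_sandwich[OF _ _ tendsto_const lim])
       (auto simp: dist_norm norm_minus_commute norm_diff_reg_min_le[OF assms(1)])
  then show ?thesis by (rule tendsto_dist_iff[THEN iffD2])
qed

text \<open>The loss functions themselves coincide, hence so do the chosen minimizers.\<close>

lemma reg_min_permute:
  assumes "bij_betw \<pi> I I"
  shows "reg_min I (\<lambda>i. a (\<pi> i)) \<mu> = reg_min I a \<mu>"
proof -
  have "reg_loss I (\<lambda>i. a (\<pi> i)) \<mu> = reg_loss I a \<mu>"
    unfolding reg_loss_def
    using sum.reindex_bij_betw[OF assms, of "\<lambda>i. ln (1 + exp (- (_ \<bullet> a i)))"] by simp
  then show ?thesis by (simp add: reg_min_def)
qed

lemma reg_min_cong:
  assumes "\<And>i. i \<in> I \<Longrightarrow> a i = b i"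
  shows "reg_min I a \<mu> = reg_min I b \<mu>"
proof -
  have "reg_loss I a \<mu> = reg_loss I b \<mu>"
    unfolding reg_loss_def using assms by simp
  then show ?thesis by (simp add: reg_min_def)
qed

section \<open>Leverage scores\<close>

text \<open>
  The \<open>c i\<close> are the quadratic forms \<open>x\<^sub>i\<^sup>T A\<inverse> x\<^sub>i\<close>, where \<open>A\<close> is the operator of the quadratic form on the right;
  their weighted sum is the trace of \<open>A\<inverse> (A - \<mu>)\<close>.
\<close>
lemma leverage_scores:
  fixes x :: "'i \<Rightarrow> 'a::euclidean_space" and s :: "'i \<Rightarrow> real"
  assumes "finite I" "\<mu> > 0" and s: "\<And>i. i \<in> I \<Longrightarrow> 0 \<le> s i"
  obtains c :: "'i \<Rightarrow> real" where "\<And>i. 0 \<le> c i" "(\<Sum>i\<in>I. s i * c i) \<le> real DIM('a)"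
    "\<And>i v. (v \<bullet> x i)\<^sup>2 \<le> c i * ((\<Sum>j\<in>I. s j * (v \<bullet> x j)\<^sup>2) + \<mu> * (norm v)\<^sup>2)"
proof -
  define A where "A v = (\<Sum>j\<in>I. (s j * (v \<bullet> x j)) *\<^sub>R x j) + \<mu> *\<^sub>R v" for v
  have lin: "linear A"
    by (rule linearI)
       (simp_all add: A_def inner_add_left algebra_simps sum.distrib scaleR_sum_right)
  have quad: "v \<bullet> A v = (\<Sum>j\<in>I. s j * (v \<bullet> x j)\<^sup>2) + \<mu> * (norm v)\<^sup>2" for v
    by (simp add: A_def inner_add_right inner_sum_right power2_eq_square dot_square_norm mult_ac)
  have sym: "v \<bullet> A w = w \<bullet> A v" for v w
    by (simp add: A_def inner_add_right inner_sum_right inner_commute mult_ac)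
  have low: "\<mu> * (norm v)\<^sup>2 \<le> v \<bullet> A v" for v
    unfolding quad using s by (simp add: sum_nonneg)
  have pos: "0 \<le> v \<bullet> A v" for v
    using low[of v] \<open>\<mu> > 0\<close> by (meson mult_nonneg_nonneg order_trans less_imp_le zero_le_power2)
  have zero: "v = 0" if "v \<bullet> A v = 0" for v
    using low[of v] that \<open>\<mu> > 0\<close> by (simp add: mult_le_0_iff)
  \<comment> \<open>Positive definiteness makes \<open>A\<close> invertible; \<open>C\<close> is its
    inverse.\<close>
  have "inj A"
    unfolding linear_injective_0[OF lin] using zero by force
  then obtain C where C: "linear C" "\<And>x. C (A x) = x" "\<And>x. A (C x) = x"
    using linear_injective_isomorphism[OF lin] by blast
  \<comment> \<open>Cauchy-Schwarz for the inner product induced by \<open>A\<close>, from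
    nonnegativity of the form at \<open>g *\<^sub>R v - q *\<^sub>R w\<close>.\<close>
  have CS: "(v \<bullet> A w)\<^sup>2 \<le> (w \<bullet> A w) * (v \<bullet> A v)" for v w
  proof (cases "w \<bullet> A w = 0")
    case True
    then have "w = 0" by (rule zero)
    then show ?thesis by (simp add: linear_0[OF lin])
  next
    case False
    define g q where "g = w \<bullet> A w" and "q = v \<bullet> A w"
    have "g > 0" using False pos[of w] by (simp add: g_def)
    have "0 \<le> (g *\<^sub>R v - q *\<^sub>R w) \<bullet> A (g *\<^sub>R v - q *\<^sub>R w)" by (rule pos)
    also have "\<dots> = g * (g * (v \<bullet> A v) - q\<^sup>2)"
      by (simp add: linear_diff[OF lin] linear_cmul[OF lin] inner_diff_left inner_diff_right
          sym[of w v] flip: g_def q_def) (simp add: algebra_simps power2_eq_square)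
    finally show ?thesis
      using \<open>g > 0\<close> by (simp add: zero_le_mult_iff g_def q_def)
  qed
  define c where "c i = C (x i) \<bullet> A (C (x i))" for i
  show ?thesis
  proof (rule that[of c])
    show "0 \<le> c i" for i unfolding c_def by (rule pos)
    show "(v \<bullet> x i)\<^sup>2 \<le> c i * ((\<Sum>j\<in>I. s j * (v \<bullet> x j)\<^sup>2) + \<mu> * (norm v)\<^sup>2)" for i v
      using CS[of v "C (x i)"] by (simp add: c_def quad[symmetric] C(3))
    have Csum: "(\<Sum>i\<in>I. (s i * (b \<bullet> x i)) *\<^sub>R C (x i)) = b - \<mu> *\<^sub>R C b" for b
    proof -
      have "(\<Sum>i\<in>I. (s i * (b \<bullet> x i)) *\<^sub>R C (x i)) = C (A b - \<mu> *\<^sub>R b)"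
        by (simp add: A_def linear_sum[OF C(1)] linear_cmul[OF C(1)])
      then show ?thesis by (simp add: linear_diff[OF C(1)] linear_cmul[OF C(1)] C(2))
    qed
    \<comment> \<open>The trace in the standard basis: each diagonal entry is 1 minus a nonnegative
      ridge correction.\<close>
    have "(\<Sum>i\<in>I. s i * c i) = (\<Sum>i\<in>I. \<Sum>b\<in>Basis. s i * ((C (x i) \<bullet> b) * (x i \<bullet> b)))"
      unfolding c_def C(3) by (subst euclidean_inner) (simp add: sum_distrib_left)
    also have "\<dots> = (\<Sum>b\<in>Basis. (\<Sum>i\<in>I. (s i * (b \<bullet> x i)) *\<^sub>R C (x i)) \<bullet> b)"
      by (subst sum.swap) (simp add: inner_sum_left inner_sum_right inner_commute mult_ac)
    also have "\<dots> = (\<Sum>b\<in>(Basis::'a set). 1 - \<mu> * (C b \<bullet> A (C b)))"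
      unfolding Csum C(3) by (intro sum.cong) (auto simp: inner_diff_left inner_Basis)
    also have "\<dots> \<le> (\<Sum>b\<in>(Basis::'a set). 1)"
      using pos \<open>\<mu> > 0\<close> by (intro sum_mono) simp
    finally show "(\<Sum>i\<in>I. s i * c i) \<le> real DIM('a)" by simp
  qed
qed

section \<open>Flipping the virtual label\<close>

lemma sigmoid_mvt:
  obtains \<xi> where "\<xi> \<in> closed_segment u v"
    "sigmoid v - sigmoid u = (sigmoid \<xi> * sigmoid (- \<xi>)) * (v - u)"
proof -
  consider "u < v" | "v < u" | "u = v" by linarith
  then show ?thesis
  proof cases
    case 1
    then obtain z where "u < z" "z < v" "sigmoid v - sigmoid u = (v - u) * (sigmoid z * sigmoid (- z))"
      using MVT2[OF 1, of sigmoid "\<lambda>x. sigmoid x * sigmoid (- x)"] DERIV_sigmoid by blast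
    then show ?thesis
      by (intro that[of z]) (auto simp: closed_segment_eq_real_ivl algebra_simps)
  next
    case 2
    then obtain z where "v < z" "z < u" "sigmoid u - sigmoid v = (u - v) * (sigmoid z * sigmoid (- z))"
      using MVT2[OF 2, of sigmoid "\<lambda>x. sigmoid x * sigmoid (- x)"] DERIV_sigmoid by blast
    then show ?thesis
      by (intro that[of z]) (auto simp: closed_segment_eq_real_ivl algebra_simps)
  qed (auto intro: that[of u])
qed

text \<open>With 0/1 responses \<open>(1 + y i) / 2\<close> the labels enter additively, so
  subtracting two such conditions isolates a changed label.\<close>

lemma reg_min_labels_stationary:
  fixes x :: "'i \<Rightarrow> 'a::euclidean_space"
  assumes "\<mu> > 0" and y: "\<And>i. i \<in> I \<Longrightarrow> y i \<in> {-1, 1::real}"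
  defines "\<theta> \<equiv> reg_min I (\<lambda>i. y i *\<^sub>R x i) \<mu>"
  shows "\<mu> *\<^sub>R \<theta> = (\<Sum>i\<in>I. ((1 + y i) / 2 - sigmoid (\<theta> \<bullet> x i)) *\<^sub>R x i)"
proof -
  have "\<mu> *\<^sub>R \<theta> = (\<Sum>i\<in>I. sigmoid (- (\<theta> \<bullet> (y i *\<^sub>R x i))) *\<^sub>R (y i *\<^sub>R x i))"
    using reg_grad_reg_min[OF assms(1), of I "\<lambda>i. y i *\<^sub>R x i"]
    unfolding reg_grad_def \<theta>_def by simp
  also have "\<dots> = (\<Sum>i\<in>I. ((1 + y i) / 2 - sigmoid (\<theta> \<bullet> x i)) *\<^sub>R x i)"
    by (intro sum.cong) (use y in \<open>force simp: sigmoid_minus\<close>)+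
  finally show ?thesis .
qed

text \<open>
  The two minimizers differ by at most \<open>1 / (2 * R)\<close>, so that by self-concordance the Hessian
  weights between them are within a factor \<open>exp (1/2)\<close> of those at the minimizer for the true label.
  The latter does not single out \<open>k\<close>.
\<close>
lemma sigmoid_diff_virtual_labels:
  fixes x :: "'i \<Rightarrow> 'a::euclidean_space"
  assumes fin: "finite I" and k: "k \<in> I" and R: "R > 0"
    and x: "\<And>i. i \<in> I \<Longrightarrow> norm (x i) \<le> R"
    and y: "\<And>i. i \<in> I \<Longrightarrow> y i \<in> {-1, 1}"
  defines "\<theta> b \<equiv> reg_min I (\<lambda>i. (y(k := b)) i *\<^sub>R x i) (2 * R\<^sup>2)"
  defines "s i \<equiv> sigmoid (\<theta> (y k) \<bullet> x i) * sigmoid (- (\<theta> (y k) \<bullet> x i))"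
  assumes c: "0 \<le> c"
    and lev: "\<And>v. (v \<bullet> x k)\<^sup>2 \<le> c * ((\<Sum>j\<in>I. s j * (v \<bullet> x j)\<^sup>2) + 2 * R\<^sup>2 * (norm v)\<^sup>2)"
  shows "sigmoid (\<theta> 1 \<bullet> x k) - sigmoid (\<theta> (-1) \<bullet> x k) \<le> exp 1 * (s k * c)"
proof -
  define \<mu> where "\<mu> = 2 * R\<^sup>2"
  have \<mu>: "\<mu> > 0" using R by (simp add: \<mu>_def)
  define D where "D = \<theta> 1 - \<theta> (-1)"
  define p where "p = D \<bullet> x k"
  define g where "g i = sigmoid (\<theta> 1 \<bullet> x i) - sigmoid (\<theta> (-1) \<bullet> x i)" for i
  have stat: "\<mu> *\<^sub>R \<theta> b = (\<Sum>i\<in>I. ((1 + (y(k := b)) i) / 2 - sigmoid (\<theta> b \<bullet> x i)) *\<^sub>R x i)"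
    if "b \<in> {-1, 1}" for b
    unfolding \<theta>_def \<mu>_def[symmetric] using y that
    by (intro reg_min_labels_stationary \<mu>) auto
  \<comment> \<open>Only the response of \<open>k\<close> differs between the two conditions, and by
    exactly 1, so a single \<open>x k\<close> survives.\<close>
  have "\<mu> *\<^sub>R D = (\<Sum>i\<in>I. ((if i = k then 1 else 0) - g i) *\<^sub>R x i)"
    unfolding D_def scaleR_diff_right
    by (subst (1 2) stat) (auto simp: g_def sum_subtractf[symmetric] scaleR_diff_left[symmetric]
        intro!: sum.cong)
  also have "\<dots> = x k - (\<Sum>i\<in>I. g i *\<^sub>R x i)"
    using fin k by (simp add: scaleR_diff_left sum_subtractf if_distrib[of "\<lambda>r. r *\<^sub>R _"] cong: if_cong)
  finally have eq: "\<mu> *\<^sub>R D = x k - (\<Sum>i\<in>I. g i *\<^sub>R x i)" .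
  have "\<exists>\<xi>. g i = (sigmoid \<xi> * sigmoid (- \<xi>)) * (D \<bullet> x i) \<and>
      \<xi> \<in> closed_segment (\<theta> (-1) \<bullet> x i) (\<theta> 1 \<bullet> x i)" for i
    using sigmoid_mvt[of "\<theta> (-1) \<bullet> x i" "\<theta> 1 \<bullet> x i"]
    by (metis g_def D_def inner_diff_left)
  then obtain \<xi> where g: "\<And>i. g i = (sigmoid (\<xi> i) * sigmoid (- \<xi> i)) * (D \<bullet> x i)"
    and \<xi>: "\<And>i. \<xi> i \<in> closed_segment (\<theta> (-1) \<bullet> x i) (\<theta> 1 \<bullet> x i)"
    by metis
  define t where "t i = sigmoid (\<xi> i) * sigmoid (- \<xi> i)" for i
  have t0: "0 \<le> t i" for i by (simp add: t_def sigmoid_pos less_imp_le)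
  have s0: "0 \<le> s i" for i by (simp add: s_def sigmoid_pos less_imp_le)
  \<comment> \<open>Pairing the difference equation with \<open>D\<close>: the gap \<open>p\<close>
    is the quadratic form of the intermediate Hessian, ridge included, at \<open>D\<close>.\<close>
  have p_eq: "p = (\<Sum>i\<in>I. t i * (D \<bullet> x i)\<^sup>2) + \<mu> * (norm D)\<^sup>2"
  proof -
    have "\<mu> * (norm D)\<^sup>2 = D \<bullet> (\<mu> *\<^sub>R D)" by (simp add: power2_norm_eq_inner)
    also have "\<dots> = p - (\<Sum>i\<in>I. t i * (D \<bullet> x i)\<^sup>2)"
      unfolding eq by (simp add: p_def inner_diff_right inner_sum_right g t_def power2_eq_square mult_ac)
    finally show ?thesis by simp
  qed
  have p_ge: "\<mu> * (norm D)\<^sup>2 \<le> p"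
    unfolding p_eq using t0 by (simp add: sum_nonneg)
  have "p \<le> norm D * R"
    unfolding p_def using norm_cauchy_schwarz[of D "x k"] x[OF k]
    by (meson mult_left_mono norm_ge_zero order_trans)
  \<comment> \<open>The choice \<open>\<mu> = 2 * R\<^sup>2\<close> is what produces the bound 1/2
    here.\<close>
  with p_ge have "norm D * (2 * R * (R * norm D)) \<le> norm D * R"
    by (simp add: \<mu>_def power2_eq_square mult_ac)
  then have D: "R * norm D \<le> 1 / 2"
    using R by (cases "norm D = 0") (auto simp: mult_le_cancel_left)
  have Dx: "\<bar>D \<bullet> x i\<bar> \<le> 1 / 2" if "i \<in> I" for i
    using Cauchy_Schwarz_ineq2[of D "x i"] mult_left_mono[OF x[OF that], of "norm D"] D
    by (simp add: mult.commute)
  \<comment> \<open>As \<open>y k\<close> is 1 or -1, \<open>\<theta> (y k) \<bullet> x i\<close> is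
    an endpoint of the segment containing \<open>\<xi> i\<close>, whose length is at most
    1/2.\<close>
  have near: "\<bar>\<xi> i - \<theta> (y k) \<bullet> x i\<bar> \<le> 1 / 2" if "i \<in> I" for i
    using \<xi>[of i] Dx[OF that] y[OF k]
    by (auto simp: closed_segment_eq_real_ivl D_def inner_diff_left split: if_splits)
  have ts: "t i \<le> exp (1/2) * s i" "s i \<le> exp (1/2) * t i" if "i \<in> I" for i
  proof -
    have e: "exp \<bar>\<xi> i - \<theta> (y k) \<bullet> x i\<bar> \<le> exp (1/2)" using near[OF that] by simp
    show "t i \<le> exp (1/2) * s i"
      using sigmoid_deriv_ratio[of "\<xi> i" "\<theta> (y k) \<bullet> x i"] mult_right_mono[OF e s0[of i]]
      by (simp add: t_def s_def)
    show "s i \<le> exp (1/2) * t i"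
      using sigmoid_deriv_ratio[of "\<theta> (y k) \<bullet> x i" "\<xi> i"] mult_right_mono[OF e t0[of i]]
      by (simp add: t_def s_def abs_minus_commute)
  qed
  have p0: "0 \<le> p" using p_ge \<mu> by (meson mult_nonneg_nonneg order_trans less_imp_le zero_le_power2)
  \<comment> \<open>Applying \<open>lev\<close> to \<open>D\<close> and passing from
    \<open>s\<close> to \<open>t\<close> at cost \<open>exp (1/2)\<close> bounds
    \<open>p * p\<close> by a multiple of \<open>p\<close>, which then cancels.\<close>
  have "p \<le> exp (1/2) * c"
  proof -
    have "(\<Sum>j\<in>I. s j * (D \<bullet> x j)\<^sup>2) \<le> (\<Sum>j\<in>I. exp (1/2) * (t j * (D \<bullet> x j)\<^sup>2))"
      using ts(2) by (intro sum_mono) (simp add: mult.assoc[symmetric] mult_right_mono)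
    moreover have "1 * (\<mu> * (norm D)\<^sup>2) \<le> exp (1/2) * (\<mu> * (norm D)\<^sup>2)"
      using \<mu> by (intro mult_right_mono) auto
    ultimately have "(\<Sum>j\<in>I. s j * (D \<bullet> x j)\<^sup>2) + \<mu> * (norm D)\<^sup>2 \<le> exp (1/2) * p"
      unfolding p_eq by (simp add: distrib_left sum_distrib_left)
    then have "c * ((\<Sum>j\<in>I. s j * (D \<bullet> x j)\<^sup>2) + \<mu> * (norm D)\<^sup>2) \<le> c * (exp (1/2) * p)"
      using c by (rule mult_left_mono)
    then have "p * p \<le> p * (exp (1/2) * c)"
      using lev[of D] unfolding \<mu>_def[symmetric] by (simp add: p_def power2_eq_square mult_ac)
    then show ?thesis
      using p0 c by (cases "p = 0") (auto simp: mult_le_cancel_left)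
  qed
  \<comment> \<open>The quantity to bound is \<open>t k * p\<close>; passing from \<open>t k\<close>
    to \<open>s k\<close> costs the second \<open>exp (1/2)\<close>.\<close>
  then have "t k * p \<le> (exp (1/2) * s k) * (exp (1/2) * c)"
    using ts(1)[OF k] p0 s0 by (intro mult_mono) auto
  also have "\<dots> = exp 1 * (s k * c)"
    by (simp add: mult_exp_exp mult.assoc mult.left_commute[of "s k"] flip: exp_add mult.assoc)
  finally show ?thesis
    using g[of k] by (simp add: g_def t_def p_def)
qed

section \<open>The Sample Minmax Predictor\<close>

text \<open>The virtual observation takes index 0, so the sum has \<open>n + 1\<close> terms.
  Dividing by \<open>n + 1\<close> preserves the order of the values and hence the
  minimizers.\<close>

lemma ridge_estimator_eq_reg_min:
  "ridge_estimator lam n xs ys x y =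
     reg_min {0..n} (\<lambda>i. if i = 0 then y *\<^sub>R x else ys i *\<^sub>R xs i) ((real n + 1) * lam)"
proof -
  let ?a = "\<lambda>i. if i = 0 then y *\<^sub>R x else ys i *\<^sub>R xs i"
  have "ridge_objective lam n xs ys x y \<theta> = reg_loss {0..n} ?a ((real n + 1) * lam) \<theta> / (real n + 1)" for \<theta>
  proof -
    have "(\<Sum>i=0..n. ln (1 + exp (- (\<theta> \<bullet> ?a i)))) =
        (\<Sum>i=1..n. ln (1 + exp (- ys i * (\<theta> \<bullet> xs i)))) + ln (1 + exp (- y * (\<theta> \<bullet> x)))"
      by (subst sum.atLeast_Suc_atMost) auto
    then show ?thesis
      unfolding ridge_objective_def reg_loss_def by (simp add: field_simps)
  qed
  then show ?thesis
    unfolding ridge_estimator_def reg_min_def arg_min_def is_arg_min_def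
    by (simp add: divide_less_cancel)
qed

lemma ridge_estimator_cong:
  assumes "\<And>i. i \<in> {1..n} \<Longrightarrow> xs i = xs' i" "\<And>i. i \<in> {1..n} \<Longrightarrow> ys i = ys' i"
  shows "ridge_estimator lam n xs ys x y = ridge_estimator lam n xs' ys' x y"
  unfolding ridge_estimator_eq_reg_min using assms by (intro reg_min_cong) auto

lemma ridge_logistic_smp_cong:
  assumes "\<And>i. i \<in> {1..n} \<Longrightarrow> xs i = xs' i" "\<And>i. i \<in> {1..n} \<Longrightarrow> ys i = ys' i"
  shows "ridge_logistic_smp lam n xs ys y x = ridge_logistic_smp lam n xs' ys' y x"
  unfolding ridge_logistic_smp_def smp_weight_def
  using ridge_estimator_cong[of n xs xs' ys ys', OF assms] by simp

lemma smp_weight_pos: "0 < smp_weight lam n xs ys y x"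
  by (simp add: smp_weight_def sigmoid_pos)

lemma smp_weight_nonzero:
  "smp_weight lam n xs ys y x \<noteq> 0" "smp_weight lam n xs ys y x + smp_weight lam n xs ys y' x \<noteq> 0"
  using smp_weight_pos[of lam n xs ys _ x] by (simp_all add: less_imp_neq[symmetric] add_pos_pos)

lemma smp_weight_le:
  assumes "lam \<ge> 0"
  shows "smp_weight lam n xs ys y x \<le> sigmoid (y * (ridge_estimator lam n xs ys x y \<bullet> x))"
  unfolding smp_weight_def using assms sigmoid_pos
  by (intro mult_left_le) (auto simp: less_imp_le)

text \<open>The logarithm of the normalizer is bounded by \<open>ln t \<le> t - 1\<close>; dropping
  the ridge factors of the weights and using \<open>sigmoid (- u) = 1 - sigmoid u\<close> leaves the
  sigmoid difference.\<close>

lemma minus_ln_ridge_logistic_smp_le: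
  assumes lam: "lam \<ge> 0"
  shows "- ln (ridge_logistic_smp lam n xs ys y x) \<le>
    ln (1 + exp (- (y * (ridge_estimator lam n xs ys x y \<bullet> x))))
    + lam / 2 * (norm (ridge_estimator lam n xs ys x y))\<^sup>2
    + (sigmoid (ridge_estimator lam n xs ys x 1 \<bullet> x) - sigmoid (ridge_estimator lam n xs ys x (-1) \<bullet> x))"
proof -
  let ?W = "\<lambda>y. smp_weight lam n xs ys y x" and ?\<theta> = "\<lambda>y. ridge_estimator lam n xs ys x y"
  have "- ln (ridge_logistic_smp lam n xs ys y x) = - ln (?W y) + ln (?W 1 + ?W (-1))"
    unfolding ridge_logistic_smp_def by (subst ln_div) (simp_all add: smp_weight_nonzero)
  moreover have "- ln (?W y) = ln (1 + exp (- (y * (?\<theta> y \<bullet> x)))) + lam / 2 * (norm (?\<theta> y))\<^sup>2"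
    unfolding smp_weight_def
    by (subst ln_mult) (simp_all add: less_imp_neq[OF sigmoid_pos, symmetric] flip: minus_ln_sigmoid)
  moreover have "ln (?W 1 + ?W (-1)) \<le> (?W 1 + ?W (-1)) - 1"
    by (intro ln_le_minus_one add_pos_pos smp_weight_pos)
  moreover have "?W 1 + ?W (-1) \<le> sigmoid (?\<theta> 1 \<bullet> x) + (1 - sigmoid (?\<theta> (-1) \<bullet> x))"
    using smp_weight_le[OF lam, of n xs ys 1 x] smp_weight_le[OF lam, of n xs ys "-1" x]
    by (simp add: sigmoid_minus)
  ultimately show ?thesis by linarith
qed

text \<open>A function of all \<open>n + 1\<close> pairs with the test pair in slot 0, so that
  permuting indices can exchange it with a sample point.\<close>

definition smp_loss :: "real \<Rightarrow> nat \<Rightarrow> (nat \<Rightarrow> (real ^ 'd) \<times> real) \<Rightarrow> real" where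
  "smp_loss lam n z =
     - ln (ridge_logistic_smp lam n (\<lambda>i. fst (z i)) (\<lambda>i. snd (z i)) (snd (z 0)) (fst (z 0)))"

lemma smp_loss_cong: "(\<And>i. i \<le> n \<Longrightarrow> z i = z' i) \<Longrightarrow> smp_loss lam n z = smp_loss lam n z'"
  unfolding smp_loss_def
  using ridge_logistic_smp_cong[of n "\<lambda>i. fst (z i)" "\<lambda>i. fst (z' i)" "\<lambda>i. snd (z i)" "\<lambda>i. snd (z' i)"]
  by auto

section \<open>Exchanging the test pair with an observation\<close>

lemma bij_betw_transposition:
  assumes "k \<le> n" shows "bij_betw (Transposition.transpose 0 k) {0..n} {0..n::nat}"
  using assms
  by (intro bij_betw_byWitness[where f' = "Transposition.transpose 0 k"])
     (auto simp: Transposition.transpose_def)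

text \<open>After the exchange the virtual label \<open>b\<close> overwrites the label of
  observation \<open>k\<close>. For \<open>b = y k\<close> nothing changes, so every
  \<open>k\<close> gives the same minimizer.\<close>

lemma ridge_estimator_transposition:
  assumes "k \<le> n"
  shows "ridge_estimator lam n (\<lambda>i. x (Transposition.transpose 0 k i)) (\<lambda>i. y (Transposition.transpose 0 k i)) (x k) b
    = reg_min {0..n} (\<lambda>i. (y(k := b)) i *\<^sub>R x i) ((real n + 1) * lam)"
  unfolding ridge_estimator_eq_reg_min
  by (subst reg_min_permute[OF bij_betw_transposition[OF assms], symmetric])
     (auto intro!: reg_min_cong simp: Transposition.transpose_def)

text \<open>With the true label every estimator is the common minimizer \<open>T\<close>, so the
  individual bounds add up to the regularized loss at \<open>T\<close> plus \<open>exp 1\<close>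
  times a sum of weighted leverage scores, all built at \<open>T\<close>.\<close>

lemma sum_smp_loss_le:
  fixes z :: "nat \<Rightarrow> (real ^ 'd) \<times> real"
  assumes R: "R > 0" and x: "\<And>i. i \<le> n \<Longrightarrow> norm (fst (z i)) \<le> R"
    and y: "\<And>i. i \<le> n \<Longrightarrow> snd (z i) \<in> {-1, 1}"
  defines "lam \<equiv> 2 * R\<^sup>2 / (real n + 1)"
  shows "(\<Sum>k=0..n. smp_loss lam n (\<lambda>i. z (Transposition.transpose 0 k i)))
    \<le> (\<Sum>i=0..n. ln (1 + exp (- (snd (z i) * (\<theta> \<bullet> fst (z i)))))) + R\<^sup>2 * (norm \<theta>)\<^sup>2
      + exp 1 * real CARD('d)"
proof -
  define T where "T = reg_min {0..n} (\<lambda>i. snd (z i) *\<^sub>R fst (z i)) (2 * R\<^sup>2)"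
  define s where "s i = sigmoid (T \<bullet> fst (z i)) * sigmoid (- (T \<bullet> fst (z i)))" for i
  let ?l = "\<lambda>\<theta> i. ln (1 + exp (- (snd (z i) * (\<theta> \<bullet> fst (z i)))))"
  have lam: "lam > 0" "(real n + 1) * lam = 2 * R\<^sup>2"
    using R by (auto simp: lam_def)
  obtain c :: "nat \<Rightarrow> real" where c: "\<And>i. 0 \<le> c i" "(\<Sum>i\<in>{0..n}. s i * c i) \<le> DIM(real ^ 'd)"
    "\<And>i v. (v \<bullet> fst (z i))\<^sup>2 \<le> c i * ((\<Sum>j\<in>{0..n}. s j * (v \<bullet> fst (z j))\<^sup>2) + 2 * R\<^sup>2 * (norm v)\<^sup>2)"
    using R leverage_scores[of "{0..n}" "2 * R\<^sup>2" s "\<lambda>i. fst (z i)"]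
    by (auto simp: s_def sigmoid_pos less_imp_le)
  have "smp_loss lam n (\<lambda>i. z (Transposition.transpose 0 k i)) \<le> ?l T k + lam / 2 * (norm T)\<^sup>2 + exp 1 * (s k * c k)"
    if k: "k \<in> {0..n}" for k
  proof -
    define \<theta> where "\<theta> b = reg_min {0..n} (\<lambda>i. ((\<lambda>i. snd (z i))(k := b)) i *\<^sub>R fst (z i)) (2 * R\<^sup>2)" for b
    have est: "ridge_estimator lam n (\<lambda>i. fst (z (Transposition.transpose 0 k i)))
        (\<lambda>i. snd (z (Transposition.transpose 0 k i))) (fst (z k)) b = \<theta> b" for b
      unfolding \<theta>_def lam(2)[symmetric] using k
      by (intro ridge_estimator_transposition[where x = "\<lambda>i. fst (z i)" and y = "\<lambda>i. snd (z i)"]) simp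
    have "(\<lambda>i. snd (z i))(k := snd (z k)) = (\<lambda>i. snd (z i))" by auto
    then have T: "\<theta> (snd (z k)) = T"
      by (simp only: \<theta>_def T_def)
    have s: "s i = sigmoid (\<theta> (snd (z k)) \<bullet> fst (z i)) * sigmoid (- (\<theta> (snd (z k)) \<bullet> fst (z i)))" for i
      unfolding T s_def ..
    have "sigmoid (\<theta> 1 \<bullet> fst (z k)) - sigmoid (\<theta> (-1) \<bullet> fst (z k)) \<le> exp 1 * (s k * c k)"
      unfolding s \<theta>_def
      by (rule sigmoid_diff_virtual_labels[where x = "\<lambda>i. fst (z i)" and y = "\<lambda>i. snd (z i)",
            OF finite_atLeastAtMost k R _ _ c(1) c(3)[unfolded s \<theta>_def]]) (use x y in auto)
    then show ?thesis
      using minus_ln_ridge_logistic_smp_le[of lam n "\<lambda>i. fst (z (Transposition.transpose 0 k i))"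
          "\<lambda>i. snd (z (Transposition.transpose 0 k i))" "snd (z k)" "fst (z k)"] lam(1)
      by (simp add: smp_loss_def est T)
  qed
  then have "(\<Sum>k=0..n. smp_loss lam n (\<lambda>i. z (Transposition.transpose 0 k i)))
      \<le> (\<Sum>k=0..n. ?l T k + lam / 2 * (norm T)\<^sup>2 + exp 1 * (s k * c k))"
    by (rule sum_mono)
  also have "\<dots> = (\<Sum>k=0..n. ?l T k) + (real n + 1) * lam / 2 * (norm T)\<^sup>2 + exp 1 * (\<Sum>k\<in>{0..n}. s k * c k)"
    by (simp add: sum.distrib sum_distrib_left)
  \<comment> \<open>By the choice of \<open>lam\<close> the \<open>n + 1\<close> ridge terms form
    the ridge term of \<open>reg_loss\<close>, so minimality of \<open>T\<close> applies
    next.\<close>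
  also have "\<dots> = reg_loss {0..n} (\<lambda>i. snd (z i) *\<^sub>R fst (z i)) (2 * R\<^sup>2) T + exp 1 * (\<Sum>k\<in>{0..n}. s k * c k)"
    unfolding lam(2) by (simp add: reg_loss_def)
  also have "\<dots> \<le> reg_loss {0..n} (\<lambda>i. snd (z i) *\<^sub>R fst (z i)) (2 * R\<^sup>2) \<theta> + exp 1 * real CARD('d)"
    unfolding T_def using R c(2) by (intro add_mono reg_min_le mult_left_mono) auto
  finally show ?thesis by (simp add: reg_loss_def)
qed

section \<open>Boundedness and continuity of the loss\<close>

lemma smp_loss_bounded:
  assumes "lam > 0" "0 \<le> R"
  obtains C where "\<And>z. norm (fst (z 0)) \<le> R \<Longrightarrow> snd (z 0) \<in> {-1, 1} \<Longrightarrow> \<bar>smp_loss lam n z\<bar> \<le> C"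
proof -
  \<comment> \<open>The uniform bound on the norm of the estimators. It confines the scores to
    \<open>[- K * R, K * R]\<close>, and so the weights to \<open>[w, 1]\<close>.\<close>
  define K where "K = sqrt (2 * real (card {0..n}) * ln 2 / ((real n + 1) * lam))"
  define w where "w = sigmoid (- (K * R)) * exp (- lam * K\<^sup>2 / 2)"
  have K0: "0 \<le> K" using assms by (simp add: K_def)
  have K: "norm (ridge_estimator lam n xs ys x y) \<le> K" for xs ys y and x :: "real ^ 'd"
    unfolding ridge_estimator_eq_reg_min K_def using assms by (intro norm_reg_min_le) simp
  have "w > 0" by (simp add: w_def sigmoid_pos)
  have low: "w \<le> smp_weight lam n xs ys y x" if "norm x \<le> R" "y \<in> {-1, 1}" for xs ys y and x :: "real ^ 'd"
  proof -
    let ?t = "ridge_estimator lam n xs ys x y"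
    have "norm ?t * norm x \<le> K * R" using K[of xs ys x y] K0 that assms(2) by (intro mult_mono) auto
    then have "\<bar>?t \<bullet> x\<bar> \<le> K * R" using Cauchy_Schwarz_ineq2[of ?t x] by linarith
    then have "- (K * R) \<le> y * (?t \<bullet> x)" using that by auto
    moreover have "(norm ?t)\<^sup>2 \<le> K\<^sup>2" using K[of xs ys x y] by (intro power_mono) auto
    ultimately show ?thesis
      unfolding w_def smp_weight_def using assms
      by (intro mult_mono sigmoid_mono) (auto simp: sigmoid_pos less_imp_le)
  qed
  have up: "smp_weight lam n xs ys y x \<le> 1" for xs ys y and x :: "real ^ 'd"
    using smp_weight_le[of lam n xs ys y x] sigmoid_le_1 assms by (meson less_imp_le order_trans)
  show ?thesis
  proof
    fix z :: "nat \<Rightarrow> (real ^ 'd) \<times> real"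
    assume z: "norm (fst (z 0)) \<le> R" "snd (z 0) \<in> {-1, 1}"
    let ?W = "\<lambda>y. smp_weight lam n (\<lambda>i. fst (z i)) (\<lambda>i. snd (z i)) y (fst (z 0))"
    let ?f = "ridge_logistic_smp lam n (\<lambda>i. fst (z i)) (\<lambda>i. snd (z i)) (snd (z 0)) (fst (z 0))"
    have pos: "0 < ?W y" for y by (rule smp_weight_pos)
    have sum: "0 < ?W 1 + ?W (-1)" by (intro add_pos_pos pos)
    have "?W (snd (z 0)) \<le> ?W 1 + ?W (-1)" using z(2) pos[of 1] pos[of "-1"] by auto
    then have f1: "?f \<le> 1" unfolding ridge_logistic_smp_def using sum by simp
    \<comment> \<open>The normalizer is at most 2, as each weight is at most 1.\<close>
    have "w / 2 \<le> ?f"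
      unfolding ridge_logistic_smp_def
      using low[OF z] add_mono[OF up up] sum pos
      by (intro frac_le) (auto simp: less_imp_le)
    then show "\<bar>smp_loss lam n z\<bar> \<le> - ln (w / 2)"
      using f1 \<open>w > 0\<close> unfolding smp_loss_def by (auto simp: abs_if)
  qed
qed

text \<open>The label \<open>b\<close> may depend on \<open>z\<close>, to cover the observed label
  \<open>snd (z 0)\<close> besides the constants 1 and -1.\<close>

lemma continuous_on_ridge_estimator:
  fixes b :: "(nat \<Rightarrow> (real ^ 'd) \<times> real) \<Rightarrow> real"
  assumes "lam > 0" "continuous_on UNIV b"
  shows "continuous_on UNIV (\<lambda>z. ridge_estimator lam n (\<lambda>i. fst (z i)) (\<lambda>i. snd (z i)) (fst (z 0)) (b z))"
proof -
  have coord: "((\<lambda>t. t i) \<longlongrightarrow> z i) (at z)" for z :: "nat \<Rightarrow> (real ^ 'd) \<times> real" and i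
    using continuous_on_product_coordinates[of i]
    by (auto simp: continuous_on_def)
  have b: "(b \<longlongrightarrow> b z) (at z)" for z
    using assms(2) by (auto simp: continuous_on_def)
  show ?thesis
    unfolding continuous_on_def ridge_estimator_eq_reg_min
  proof (intro ballI tendsto_reg_min)
    fix z :: "nat \<Rightarrow> (real ^ 'd) \<times> real" and i
    show "((\<lambda>t. if i = 0 then b t *\<^sub>R fst (t 0) else snd (t i) *\<^sub>R fst (t i)) \<longlongrightarrow>
      (if i = 0 then b z *\<^sub>R fst (z 0) else snd (z i) *\<^sub>R fst (z i))) (at z)"
      by (auto intro!: tendsto_intros coord b)
  qed (use assms in simp)
qed

lemma continuous_on_smp_loss:
  assumes "lam > 0"
  shows "continuous_on UNIV (smp_loss lam n :: (nat \<Rightarrow> (real ^ 'd) \<times> real) \<Rightarrow> real)"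
proof -
  have pr: "continuous_on UNIV (\<lambda>z::nat \<Rightarrow> (real ^ 'd) \<times> real. fst (z 0))"
    "continuous_on UNIV (\<lambda>z::nat \<Rightarrow> (real ^ 'd) \<times> real. snd (z 0))"
    by (intro continuous_intros continuous_on_product_coordinates)+
  have w: "continuous_on UNIV (\<lambda>z. smp_weight lam n (\<lambda>i. fst (z i)) (\<lambda>i. snd (z i)) (b z) (fst (z 0)))"
    if "continuous_on UNIV b" for b :: "(nat \<Rightarrow> (real ^ 'd) \<times> real) \<Rightarrow> real"
    unfolding smp_weight_def
    by (intro continuous_intros continuous_on_ridge_estimator assms that pr) auto
  show ?thesis
    unfolding smp_loss_def[abs_def] ridge_logistic_smp_def
    by (intro continuous_intros w pr)
       (simp_all add: smp_weight_nonzero)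
qed

section \<open>Exchangeability\<close>

lemma ln_one_plus_exp_minus_le: "ln (1 + exp (- u)) \<le> ln 2 + \<bar>u::real\<bar>"
proof -
  have "ln (1 + exp (- u)) \<le> ln (2 * exp \<bar>u\<bar>)"
    by (intro ln_mono) (auto simp: add_pos_pos intro!: order_trans[OF add_mono[of 1 "exp \<bar>u\<bar>" "exp (- u)" "exp \<bar>u\<bar>"]])
  then show ?thesis by (simp add: ln_mult)
qed

text \<open>Coordinates outside \<open>I\<close> equal \<open>undefined\<close> on the product
  space, hence are constant and measurable; so the identity is measurable into the Borel space of
  all functions.\<close>

lemma borel_measurable_PiM_continuous:
  fixes h :: "('i::countable \<Rightarrow> 'b::second_countable_topology) \<Rightarrow> real"
  assumes "continuous_on UNIV h"
  shows "h \<in> borel_measurable (PiM I (\<lambda>_. borel))"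
proof -
  have "(\<lambda>z. z i) \<in> borel_measurable (PiM I (\<lambda>_. borel :: 'b measure))" for i
  proof (cases "i \<in> I")
    case False
    then have "z i = undefined" if "z \<in> space (PiM I (\<lambda>_. borel :: 'b measure))" for z
      using that by (auto simp: space_PiM PiE_def extensional_def)
    then show ?thesis by (subst measurable_cong[where g = "\<lambda>_. undefined"]) auto
  qed (rule measurable_component_singleton)
  then have "(\<lambda>z. z) \<in> measurable (PiM I (\<lambda>_. borel :: 'b measure)) borel"
    by (rule measurable_coordinatewise_then_product)
  from measurable_compose[OF this borel_measurable_continuous_onI[OF assms]]
  show ?thesis .
qed

text \<open>The product measure is invariant under exchanging slot 0 with slot \<open>k\<close>, so
  \<open>n + 1\<close> times the expected loss is the expectation of the sum bounded pointwise
  before.\<close>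

lemma expectation_smp_loss_le:
  fixes P :: "((real ^ 'd) \<times> real) measure" and n :: nat
  assumes P: "prob_space P" "sets P = sets borel" and R: "R > 0"
    and AE_x: "AE p in P. norm (fst p) \<le> R" and AE_y: "AE p in P. snd p \<in> {-1, 1}"
  defines "lam \<equiv> 2 * R\<^sup>2 / (real n + 1)"
  defines "N \<equiv> PiM {0..n} (\<lambda>_. P)"
  shows "integrable N (smp_loss lam n)"
    and "(real n + 1) * (\<integral>z. smp_loss lam n z \<partial>N) \<le>
      (real n + 1) * (\<integral>p. ln (1 + exp (- (snd p * (\<theta> \<bullet> fst p)))) \<partial>P)
      + R\<^sup>2 * (norm \<theta>)\<^sup>2 + exp 1 * real CARD('d)"
proof -
  interpret P: prob_space P by fact
  interpret N: prob_space N unfolding N_def by (intro prob_space_PiM P)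
  have lam: "lam > 0" using R by (simp add: lam_def)
  let ?h = "smp_loss lam n :: (nat \<Rightarrow> (real ^ 'd) \<times> real) \<Rightarrow> real"
  have sN: "sets N = sets (PiM {0..n} (\<lambda>_. borel))"
    unfolding N_def using P by (intro sets_PiM_cong) auto
  have meas: "?h \<in> borel_measurable N"
    using borel_measurable_PiM_continuous[OF continuous_on_smp_loss[OF lam]]
    by (simp add: measurable_cong_sets[OF sN refl])
  have AE_N: "AE z in N. \<forall>i\<in>{0..n}. norm (fst (z i)) \<le> R \<and> snd (z i) \<in> {-1, 1}"
    unfolding N_def using AE_x AE_y
    by (intro AE_finite_allI AE_PiM_component P) auto
  obtain C where C: "\<And>z. norm (fst (z 0)) \<le> R \<Longrightarrow> snd (z 0) \<in> {-1, 1} \<Longrightarrow> \<bar>?h z\<bar> \<le> C"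
    using smp_loss_bounded[OF lam less_imp_le[OF R]] by metis
  show int: "integrable N ?h"
    using AE_N by (intro N.integrable_const_bound[where B = C] meas) (auto elim!: eventually_mono intro: C)
  have swap: "integrable N (\<lambda>z. ?h (\<lambda>i. z (Transposition.transpose 0 k i)))"
    "(\<integral>z. ?h (\<lambda>i. z (Transposition.transpose 0 k i)) \<partial>N) = (\<integral>z. ?h z \<partial>N)" if "k \<le> n" for k
  proof -
    \<comment> \<open>Points of the product space are extensional, so the exchange is restricted to
      \<open>{0..n}\<close>; the loss reads only these indices.\<close>
    let ?r = "\<lambda>z::nat \<Rightarrow> (real ^ 'd) \<times> real. \<lambda>i\<in>{0..n}. z (Transposition.transpose 0 k i)"
    have b: "bij_betw (Transposition.transpose 0 k) {0..n} {0..n}"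
      by (rule bij_betw_transposition[OF that])
    then have d: "distr N N ?r = N"
      unfolding N_def by (intro distr_PiM_reindex P) (auto simp: bij_betw_def)
    have r: "?r \<in> measurable N N"
      unfolding N_def using bij_betwE[OF b]
      by (intro measurable_restrict measurable_component_singleton) auto
    have h: "?h (?r z) = ?h (\<lambda>i. z (Transposition.transpose 0 k i))" for z
      by (rule smp_loss_cong) auto
    show "integrable N (\<lambda>z. ?h (\<lambda>i. z (Transposition.transpose 0 k i)))"
      using integrable_distr_eq[OF r, of ?h] int meas unfolding d h by simp
    show "(\<integral>z. ?h (\<lambda>i. z (Transposition.transpose 0 k i)) \<partial>N) = (\<integral>z. ?h z \<partial>N)"
      using integral_distr[OF r, of ?h] meas unfolding d h by simp
  qed
  define l where "l p = ln (1 + exp (- (snd p * (\<theta> \<bullet> fst p))))" for p :: "(real ^ 'd) \<times> real"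
  have l_meas: "l \<in> borel_measurable P"
  proof -
    have "1 + exp u \<noteq> 0" for u :: real using exp_gt_zero[of u] by linarith
    then have "continuous_on UNIV l"
      unfolding l_def[abs_def] by (intro continuous_intros) auto
    then show ?thesis
      using P(2) by (simp add: borel_measurable_continuous_onI cong: measurable_cong_sets)
  qed
  have l_bound: "\<bar>l p\<bar> \<le> ln 2 + norm \<theta> * R" if "norm (fst p) \<le> R" "snd p \<in> {-1, 1}" for p
  proof -
    have "\<bar>snd p * (\<theta> \<bullet> fst p)\<bar> \<le> norm \<theta> * norm (fst p)"
      using Cauchy_Schwarz_ineq2[of \<theta> "fst p"] that by auto
    also have "\<dots> \<le> norm \<theta> * R" using that by (simp add: mult_left_mono)
    finally show ?thesis
      using ln_one_plus_exp_minus_le[of "snd p * (\<theta> \<bullet> fst p)"] by (simp add: l_def)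
  qed
  have l_int: "integrable P l"
    using AE_x AE_y
    by (intro P.integrable_const_bound[where B = "ln 2 + norm \<theta> * R"] l_meas)
       (auto elim!: eventually_elim2 intro: l_bound)
  have comp: "integrable N (\<lambda>z. l (z i))" "(\<integral>z. l (z i) \<partial>N) = (\<integral>p. l p \<partial>P)" if "i \<le> n" for i
  proof -
    have m: "(\<lambda>z. z i) \<in> measurable N P"
      unfolding N_def using that by (intro measurable_component_singleton) auto
    have d: "distr N P (\<lambda>z. z i) = P"
      unfolding N_def using that by (intro distr_PiM_component P) auto
    show "integrable N (\<lambda>z. l (z i))"
      using integrable_distr_eq[OF m l_meas] l_int unfolding d by simp
    show "(\<integral>z. l (z i) \<partial>N) = (\<integral>p. l p \<partial>P)"
      using integral_distr[OF m l_meas] unfolding d by simp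
  qed
  have "(real n + 1) * (\<integral>z. ?h z \<partial>N) = (\<Sum>k=0..n. \<integral>z. ?h (\<lambda>i. z (Transposition.transpose 0 k i)) \<partial>N)"
    by (simp add: swap(2) algebra_simps)
  also have "\<dots> = (\<integral>z. (\<Sum>k=0..n. ?h (\<lambda>i. z (Transposition.transpose 0 k i))) \<partial>N)"
    by (intro Bochner_Integration.integral_sum[symmetric] swap(1)) auto
  also have "\<dots> \<le> (\<integral>z. (\<Sum>i=0..n. l (z i)) + (R\<^sup>2 * (norm \<theta>)\<^sup>2 + exp 1 * real CARD('d)) \<partial>N)"
  proof (rule integral_mono_AE)
    show "integrable N (\<lambda>z. \<Sum>k=0..n. ?h (\<lambda>i. z (Transposition.transpose 0 k i)))"
      by (intro Bochner_Integration.integrable_sum swap(1)) auto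
    show "integrable N (\<lambda>z. (\<Sum>i=0..n. l (z i)) + (R\<^sup>2 * (norm \<theta>)\<^sup>2 + exp 1 * real CARD('d)))"
      by (intro Bochner_Integration.integrable_add Bochner_Integration.integrable_sum comp(1)) auto
    show "AE z in N. (\<Sum>k=0..n. ?h (\<lambda>i. z (Transposition.transpose 0 k i)))
        \<le> (\<Sum>i=0..n. l (z i)) + (R\<^sup>2 * (norm \<theta>)\<^sup>2 + exp 1 * real CARD('d))"
      using AE_N
    proof eventually_elim
      case (elim z)
      then show ?case
        using sum_smp_loss_le[OF R, of n z \<theta>] by (simp add: l_def lam_def)
    qed
  qed
  also have "\<dots> = (\<Sum>i=0..n. \<integral>z. l (z i) \<partial>N) + (R\<^sup>2 * (norm \<theta>)\<^sup>2 + exp 1 * real CARD('d))"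
    by (subst Bochner_Integration.integral_add)
       (auto simp: comp(1) N.prob_space intro!: Bochner_Integration.integral_sum)
  also have "\<dots> = (real n + 1) * (\<integral>p. l p \<partial>P) + R\<^sup>2 * (norm \<theta>)\<^sup>2 + exp 1 * real CARD('d)"
    by (simp add: comp(2) algebra_simps)
  finally show "(real n + 1) * (\<integral>z. ?h z \<partial>N) \<le>
      (real n + 1) * (\<integral>p. ln (1 + exp (- (snd p * (\<theta> \<bullet> fst p)))) \<partial>P)
      + R\<^sup>2 * (norm \<theta>)\<^sup>2 + exp 1 * real CARD('d)"
    by (simp add: l_def)
qed

section \<open>The expected risk as an integral over the product measure\<close>

lemma (in prob_space) expectation_risk_smp:
  fixes X :: "nat \<Rightarrow> 'a \<Rightarrow> real ^ 'd" and Y :: "nat \<Rightarrow> 'a \<Rightarrow> real" and lam :: real and n :: nat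
  assumes lam: "lam > 0" and n: "n \<ge> 1"
    and indep: "indep_vars (\<lambda>_. borel) (\<lambda>i \<omega>. (X i \<omega>, Y i \<omega>)) {0..n}"
    and ident: "\<And>i. i \<le> n \<Longrightarrow>
      distr M borel (\<lambda>\<omega>. (X i \<omega>, Y i \<omega>)) = distr M borel (\<lambda>\<omega>. (X 0 \<omega>, Y 0 \<omega>))"
  defines "P \<equiv> distr M borel (\<lambda>\<omega>. (X 0 \<omega>, Y 0 \<omega>))"
  assumes int: "integrable (PiM {0..n} (\<lambda>_. P)) (smp_loss lam n)"
  shows "(\<integral>\<omega>. risk M (X 0) (Y 0) (ridge_logistic_smp lam n (\<lambda>i. X i \<omega>) (\<lambda>i. Y i \<omega>)) \<partial>M)
    = (\<integral>z. smp_loss lam n z \<partial>PiM {0..n} (\<lambda>_. P))"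
proof -
  define Z where "Z i \<omega> = (X i \<omega>, Y i \<omega>)" for i \<omega>
  let ?h = "smp_loss lam n :: (nat \<Rightarrow> (real ^ 'd) \<times> real) \<Rightarrow> real"
  have Z: "Z i \<in> borel_measurable M" if "i \<le> n" for i
    using indep that by (auto simp: indep_vars_def Z_def[abs_def])
  have distr_Z: "distr M borel (Z i) = P" if "i \<le> n" for i
    unfolding P_def Z_def[abs_def] using that by (rule ident)
  interpret P: prob_space P
    unfolding P_def using Z[of 0] by (intro prob_space_distr) (simp add: Z_def[abs_def])
  interpret product_sigma_finite "\<lambda>_::nat. P" by standard
  have sP: "sets P = sets borel" by (simp add: P_def)
  have PiM_sets: "sets (PiM I (\<lambda>_. P)) = sets (PiM I (\<lambda>_. borel))" for I :: "nat set"
    using sP by (intro sets_PiM_cong) auto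
  have meas: "?h \<in> borel_measurable (PiM {0..n} (\<lambda>_. P))"
    using int by auto
  let ?Zr = "\<lambda>\<omega>. \<lambda>i\<in>{1..n}. Z i \<omega>"
  have Zr: "?Zr \<in> measurable M (PiM {1..n} (\<lambda>_. P))"
    using Z by (intro measurable_restrict) (auto simp: measurable_cong_sets[OF refl sP])
  \<comment> \<open>Independence makes the law of the sample a product; \<open>n \<ge> 1\<close>
    keeps the index set nonempty for this characterization.\<close>
  have dist: "distr M (PiM {1..n} (\<lambda>_. P)) ?Zr = PiM {1..n} (\<lambda>_. P)"
  proof -
    have "indep_vars (\<lambda>_. borel) Z {1..n}"
      unfolding Z_def[abs_def] using indep by (rule indep_vars_subset) auto
    then have "distr M (PiM {1..n} (\<lambda>_. borel)) ?Zr = PiM {1..n} (\<lambda>i. distr M borel (Z i))"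
      using n Z by (subst (asm) indep_vars_iff_distr_eq_PiM') auto
    also have "\<dots> = PiM {1..n} (\<lambda>_. P)"
      using distr_Z by (intro PiM_cong) auto
    finally show ?thesis
      by (simp add: distr_cong[OF refl PiM_sets refl])
  qed
  have "insert 0 {1..n} = {0..n}" by auto
  then have PiM_ins: "PiM (insert 0 {1..n}) (\<lambda>_. P) = PiM {0..n} (\<lambda>_. P)" by simp
  \<comment> \<open>The risk for a frozen sample \<open>w\<close>, with the test pair placed in slot
    0.\<close>
  define G where "G w = (\<integral>p. ?h (w(0 := p)) \<partial>P)" for w
  have upd: "(\<lambda>(w, p). w(0 := p)) \<in> measurable (PiM {1..n} (\<lambda>_. P) \<Otimes>\<^sub>M P) (PiM {0..n} (\<lambda>_. P))"
    using measurable_add_dim[of 0 "{1..n}" "\<lambda>_. P"] by (simp only: PiM_ins)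
  then have "(\<lambda>(w, p). ?h (w(0 := p))) \<in> borel_measurable (PiM {1..n} (\<lambda>_. P) \<Otimes>\<^sub>M P)"
    using measurable_compose[OF upd meas] by (simp add: case_prod_unfold)
  then have G: "G \<in> borel_measurable (PiM {1..n} (\<lambda>_. P))"
    unfolding G_def[abs_def] by (rule P.borel_measurable_lebesgue_integral)
  \<comment> \<open>The sample is fixed while the test pair is integrated, so only the law
    \<open>P\<close> of the pair enters. Continuity in the test pair gives measurability for every
    fixed sample.\<close>
  have risk: "risk M (X 0) (Y 0) (ridge_logistic_smp lam n (\<lambda>i. X i \<omega>) (\<lambda>i. Y i \<omega>)) = G (?Zr \<omega>)" for \<omega>
  proof -
    have "continuous_on UNIV (\<lambda>p. ((?Zr \<omega>)(0 := p)) i)" for i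
      unfolding fun_upd_apply by (cases "i = 0") simp_all
    then have "continuous_on UNIV (\<lambda>p. (?Zr \<omega>)(0 := p))"
      by (rule continuous_on_coordinatewise_then_product)
    then have "continuous_on UNIV (\<lambda>p. ?h ((?Zr \<omega>)(0 := p)))"
      by (rule continuous_on_compose2[OF continuous_on_smp_loss[OF lam]]) auto
    then have "(\<lambda>p. ?h ((?Zr \<omega>)(0 := p))) \<in> borel_measurable borel"
      by (rule borel_measurable_continuous_onI)
    then have "G (?Zr \<omega>) = (\<integral>\<omega>'. ?h ((?Zr \<omega>)(0 := Z 0 \<omega>')) \<partial>M)"
      unfolding G_def P_def using Z[of 0] by (subst integral_distr) (simp_all add: Z_def[abs_def])
    also have "\<dots> = risk M (X 0) (Y 0) (ridge_logistic_smp lam n (\<lambda>i. X i \<omega>) (\<lambda>i. Y i \<omega>))"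
      unfolding risk_def smp_loss_def
      by (intro Bochner_Integration.integral_cong refl arg_cong[where f = "\<lambda>t. - ln t"])
         (auto simp: Z_def intro!: ridge_logistic_smp_cong)
    finally show ?thesis ..
  qed
  \<comment> \<open>The sample is pushed forward to its product law, and Fubini then adjoins
    coordinate 0.\<close>
  have "(\<integral>\<omega>. G (?Zr \<omega>) \<partial>M) = (\<integral>w. G w \<partial>PiM {1..n} (\<lambda>_. P))"
    using integral_distr[OF Zr G] by (simp only: dist)
  also have "\<dots> = (\<integral>z. ?h z \<partial>PiM {0..n} (\<lambda>_. P))"
    unfolding G_def using product_integral_insert[of "{1..n}" 0 ?h] int by (simp only: PiM_ins) simp
  finally show ?thesis by (simp only: risk)
qed

section \<open>The excess risk over the ball of radius \<open>B\<close>\<close>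

(* Index 0 is the test pair (X, Y); indices 1..n are the sample. *)
theorem corollary2:
  fixes M :: "'w measure"
    and X :: "nat \<Rightarrow> 'w \<Rightarrow> real ^ 'd" and Y :: "nat \<Rightarrow> 'w \<Rightarrow> real"
    and n :: nat and R B :: real
  assumes "prob_space M"
    and "n \<ge> 1"
    and labels: "\<And>i \<omega>. i \<le> n \<Longrightarrow> \<omega> \<in> space M \<Longrightarrow> Y i \<omega> \<in> {-1, 1}"
    and indep: "prob_space.indep_vars M (\<lambda>_. borel) (\<lambda>i \<omega>. (X i \<omega>, Y i \<omega>)) {0..n}"
    and ident: "\<And>i. i \<le> n \<Longrightarrow>
      distr M borel (\<lambda>\<omega>. (X i \<omega>, Y i \<omega>)) = distr M borel (\<lambda>\<omega>. (X 0 \<omega>, Y 0 \<omega>))"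
    and "R > 0"
    and bounded: "AE \<omega> in M. norm (X 0 \<omega>) \<le> R"
    and "B > 0"
  shows "(\<integral>\<omega>. risk M (X 0) (Y 0)
              (ridge_logistic_smp (2 * R\<^sup>2 / (real n + 1)) n (\<lambda>i. X i \<omega>) (\<lambda>i. Y i \<omega>)) \<partial>M)
           - (INF \<theta> \<in> {\<theta>. norm \<theta> \<le> B}. risk M (X 0) (Y 0) (logistic_model \<theta>))
         \<le> (exp 1 * real CARD('d) + B\<^sup>2 * R\<^sup>2) / real n"
proof -
  interpret prob_space M by fact
  define lam where "lam = 2 * R\<^sup>2 / (real n + 1)"
  define P where "P = distr M borel (\<lambda>\<omega>. (X 0 \<omega>, Y 0 \<omega>))"
  let ?N = "PiM {0..n} (\<lambda>_. P)"
  have Z: "(\<lambda>\<omega>. (X 0 \<omega>, Y 0 \<omega>)) \<in> borel_measurable M"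
    using indep by (auto simp: indep_vars_def)
  have P: "prob_space P" "sets P = sets borel"
    unfolding P_def using Z by (auto intro: prob_space_distr)
  have m: "(fst :: (real ^ 'd) \<times> real \<Rightarrow> _) \<in> borel_measurable borel"
    "(snd :: (real ^ 'd) \<times> real \<Rightarrow> _) \<in> borel_measurable borel"
    by (intro borel_measurable_continuous_onI continuous_intros)+
  have AE_x: "AE p in P. norm (fst p) \<le> R"
    unfolding P_def using bounded
    by (subst AE_distr_iff[OF Z]) (auto intro!: borel_closed closed_Collect_le continuous_intros)
  have "snd -` {-1, 1} \<inter> space borel \<in> sets (borel :: ((real ^ 'd) \<times> real) measure)"
    using measurable_sets[OF m(2), of "{-1, 1}"] by simp
  then have AE_y: "AE p in P. snd p \<in> {-1, 1}"
    unfolding P_def using labels[of 0]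
    by (subst AE_distr_iff[OF Z]) (auto simp: vimage_def Int_def)
  note main = expectation_smp_loss_le[OF P \<open>R > 0\<close> AE_x AE_y, of n, folded lam_def]
  have "lam > 0" using \<open>R > 0\<close> by (simp add: lam_def)
  then have lhs: "(\<integral>\<omega>. risk M (X 0) (Y 0) (ridge_logistic_smp lam n (\<lambda>i. X i \<omega>) (\<lambda>i. Y i \<omega>)) \<partial>M)
      = (\<integral>z. smp_loss lam n z \<partial>?N)"
    unfolding P_def using \<open>n \<ge> 1\<close> indep ident main(1)[unfolded P_def]
    by (rule expectation_risk_smp)
  let ?C = "(exp 1 * real CARD('d) + B\<^sup>2 * R\<^sup>2) / real n"
  \<comment> \<open>A lower bound on the risk of each \<theta> in the ball, uniform in \<theta>,
    passes to the infimum.\<close>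
  have "(\<integral>z. smp_loss lam n z \<partial>?N) - ?C \<le> risk M (X 0) (Y 0) (logistic_model \<theta>)"
    if \<theta>: "norm \<theta> \<le> B" for \<theta>
  proof -
    let ?E = "exp 1 * real CARD('d) + B\<^sup>2 * R\<^sup>2"
    have "1 + exp u \<noteq> 0" for u :: real using exp_gt_zero[of u] by linarith
    then have "continuous_on UNIV (\<lambda>p. ln (1 + exp (- (snd p * (\<theta> \<bullet> fst p)))))"
      by (intro continuous_intros) auto
    then have risk: "(\<integral>p. ln (1 + exp (- (snd p * (\<theta> \<bullet> fst p)))) \<partial>P) = risk M (X 0) (Y 0) (logistic_model \<theta>)"
      unfolding P_def risk_def logistic_model_def minus_ln_sigmoid using Z
      by (subst integral_distr) (auto intro: borel_measurable_continuous_onI)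
    have "R\<^sup>2 * (norm \<theta>)\<^sup>2 \<le> R\<^sup>2 * B\<^sup>2"
      using \<theta> by (intro mult_left_mono power_mono) auto
    then have "(real n + 1) * (\<integral>z. smp_loss lam n z \<partial>?N)
        \<le> (real n + 1) * risk M (X 0) (Y 0) (logistic_model \<theta>) + ?E"
      using main(2)[of \<theta>] unfolding risk by (simp add: mult.commute)
    then have "(\<integral>z. smp_loss lam n z \<partial>?N) \<le> risk M (X 0) (Y 0) (logistic_model \<theta>) + ?E / (real n + 1)"
      by (simp add: field_simps)
    \<comment> \<open>Averaging gives the denominator \<open>n + 1\<close>, relaxed here to
      \<open>n\<close>.\<close>
    moreover have "?E / (real n + 1) \<le> ?C"
      using \<open>n \<ge> 1\<close> by (intro divide_left_mono) auto
    ultimately show ?thesis by linarith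
  qed
  \<comment> \<open>The infimum is over a nonempty set, since \<open>B > 0\<close> puts 0 in the
    ball.\<close>
  then have "(\<integral>z. smp_loss lam n z \<partial>?N) - ?C
      \<le> (INF \<theta> \<in> {\<theta>. norm \<theta> \<le> B}. risk M (X 0) (Y 0) (logistic_model \<theta>))"
    using \<open>B > 0\<close> by (intro cINF_greatest) (auto intro: exI[of _ 0])
  then show ?thesis
    unfolding lam_def[symmetric] lhs by linarith
qed

end
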